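(* Let $F$ be a field with $\operatorname{Char}(F)\neq 2$ and let $R$ be a simple associative unital $F$-algebra. Let $*$ be an involution on $R$ of the first kind with set of symmetric elements $S$ and set of skew-symmetric elements $K$, and assume $S\subsetneq R$. Assume $S$ is not a commutative set. Then the following are equivalent: (a) there exist $x,y\in S$ such that $xy+yx\neq 0$ and for every $k\in K$, $xky\in S^2$; (b) $S^2=R$.
   Context: $S=\{r\in R: r^*=r\}$ and $K=\{r\in R: r^*=-r\}$. The involution $*$ is of the first kind if $Z(R)\subseteq S$, where $Z(R)$ is the center of $R$. A subset $A\subseteq R$ is a commutative set if $xy=yx$ for all $x,y\in A$. $S^2$ denotes the $F$-subspace of $R$ generated by all products $ab$ with $a,b\in S$. *)

theory Defs
  imports Complex_Main
begin

locale unital_algebra = vector_space scale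
  for scale :: "'f::field \<Rightarrow> 'r::ring_1 \<Rightarrow> 'r"  (infixr \<open>*s\<close> 75) +
  assumes scale_mult_left: "(c *s a) * b = c *s (a * b)"
    and scale_mult_right: "a * (c *s b) = c *s (a * b)"

definition two_sided_ideal :: "'r::ring_1 set \<Rightarrow> bool" where
  "two_sided_ideal I \<longleftrightarrow>
     0 \<in> I \<and> (\<forall>a\<in>I. \<forall>b\<in>I. a + b \<in> I) \<and> (\<forall>a\<in>I. \<forall>r. r * a \<in> I \<and> a * r \<in> I)"

text \<open>The ring is a whole type; \<open>0 \<noteq> 1\<close> is part of the class. In a unital algebra every
  ring ideal is a subspace, so simplicity as a ring and as an algebra coincide.\<close>

definition simple_ring :: "'r::ring_1 itself \<Rightarrow> bool" where
  "simple_ring _ \<longleftrightarrow> (\<forall>I::'r set. two_sided_ideal I \<longrightarrow> I = {0} \<or> I = UNIV)"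

definition center :: "'r::ring_1 set" where
  "center = {z. \<forall>r. z * r = r * z}"

definition commutative_set :: "'r::ring_1 set \<Rightarrow> bool" where
  "commutative_set A \<longleftrightarrow> (\<forall>x\<in>A. \<forall>y\<in>A. x * y = y * x)"

text \<open>An involution of the ring. Linearity over the base field is not required: it follows
  for involutions of the first kind, because the scalars \<open>c *s 1\<close> are then symmetric.\<close>

definition involution :: "('r::ring_1 \<Rightarrow> 'r) \<Rightarrow> bool" where
  "involution st \<longleftrightarrow>
     (\<forall>a b. st (a + b) = st a + st b) \<and>
     (\<forall>a b. st (a * b) = st b * st a) \<and>
     (\<forall>a. st (st a) = a)"

definition symmetric_elems :: "('r::ring_1 \<Rightarrow> 'r) \<Rightarrow> 'r set" where
  "symmetric_elems st = {r. st r = r}"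

definition skew_elems :: "('r::ring_1 \<Rightarrow> 'r) \<Rightarrow> 'r set" where
  "skew_elems st = {r. st r = - r}"

definition first_kind :: "('r::ring_1 \<Rightarrow> 'r) \<Rightarrow> bool" where
  "first_kind st \<longleftrightarrow> center \<subseteq> symmetric_elems st"

definition square_span :: "('f::field \<Rightarrow> 'r::ring_1 \<Rightarrow> 'r) \<Rightarrow> 'r set \<Rightarrow> 'r set" where
  "square_span scale A = module.span scale {a * b | a b. a \<in> A \<and> b \<in> A}"

end

theory Submission
  imports Defs
begin

text \<open>
  Write \<open>[a, b] = ab - ba\<close> and \<open>V = S\<^sup>2\<close>. If \<open>V\<close> is everything, then \<open>x = y = 1\<close> satisfies (a),
  because \<open>2 \<noteq> 0\<close>. For the converse the point is that \<open>V\<close> is a Lie ideal: it is stable under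
  \<open>[\<cdot>, r]\<close> for every \<open>r\<close>. Since \<open>2\<close> is invertible, \<open>R = S + K\<close>, so it suffices to bracket a
  product \<open>ab\<close> of symmetric elements with a skew and with a symmetric element. A skew \<open>k\<close> acts on
  \<open>S\<close> as a derivation, so \<open>[ab, k] = [a, k]b + a[b, k]\<close> is in \<open>V\<close>. For a symmetric \<open>s\<close>, the
  element \<open>2ab\<close> is the sum of the symmetric \<open>ab + ba\<close>, whose bracket with \<open>s\<close> is in \<open>V\<close> by
  definition, and the skew \<open>[a, b]\<close>, whose bracket with \<open>s\<close> is again symmetric.

  By an argument of Herstein, a Lie ideal of a simple ring that is not commutative contains
  all of \<open>[R, R]\<close> (\<open>noncommutative_lie_ideal_contains_commutators\<close>). As \<open>S \<subseteq> V\<close> is not commutative,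
  this applies to \<open>V\<close>, so modulo \<open>V\<close> products may be permuted cyclically. The hypothesis
  \<open>xky \<in> V\<close> thus gives \<open>yxk \<in> V\<close>; applying the involution, which preserves \<open>V\<close>, it also gives
  \<open>xyk \<in> V\<close>. Hence \<open>c = xy + yx\<close> satisfies \<open>cK \<subseteq> V\<close>, and \<open>cS \<subseteq> V\<close> because \<open>c\<close> is symmetric.
  So \<open>cR \<subseteq> V\<close>, and a further cyclic permutation puts the ideal generated by the nonzero element
  \<open>c\<close> into \<open>V\<close>.
\<close>

section \<open>Lie ideals of simple rings\<close>

text \<open>The elements \<open>z\<close> with \<open>RzR \<subseteq> T\<close> form an ideal contained in \<open>T\<close>.\<close>

lemma simple_ring_additive_set_eq_UNIV:
  fixes T :: "'r::ring_1 set"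
  assumes simple: "simple_ring TYPE('r)"
    and zero: "0 \<in> T"
    and add: "\<And>a b. a \<in> T \<Longrightarrow> b \<in> T \<Longrightarrow> a + b \<in> T"
    and nz: "c \<noteq> 0"
    and sandwich: "\<And>p q. p * c * q \<in> T"
  shows "T = UNIV"
proof -
  define I where "I = {z. \<forall>p q. p * z * q \<in> T}"
  have "two_sided_ideal I"
    unfolding two_sided_ideal_def
  proof (intro conjI ballI allI)
    show "0 \<in> I" by (simp add: I_def zero)
  next
    fix a b assume "a \<in> I" "b \<in> I"
    then show "a + b \<in> I" by (simp add: I_def distrib_left distrib_right add)
  next
    fix a r assume a: "a \<in> I"
    have "p * (r * a) * q \<in> T" for p q
      using a unfolding I_def by (metis (mono_tags) mem_Collect_eq mult.assoc)
    then show "r * a \<in> I" by (simp add: I_def)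
    have "p * (a * r) * q \<in> T" for p q
      using a unfolding I_def by (metis (mono_tags) mem_Collect_eq mult.assoc)
    then show "a * r \<in> I" by (simp add: I_def)
  qed
  moreover have "c \<in> I" by (simp add: I_def sandwich)
  ultimately have I: "I = UNIV"
    using simple nz unfolding simple_ring_def by blast
  have "z \<in> T" for z
  proof -
    have "1 * z * 1 \<in> T" using I unfolding I_def by blast
    then show ?thesis by simp
  qed
  then show ?thesis by blast
qed

locale additive_lie_ideal =
  fixes V :: "'r::ring_1 set"
  assumes zero_mem: "0 \<in> V"
    and add_mem: "\<And>a b. a \<in> V \<Longrightarrow> b \<in> V \<Longrightarrow> a + b \<in> V"
    and minus_mem: "\<And>a. a \<in> V \<Longrightarrow> - a \<in> V"
    and bracket_mem: "\<And>a r. a \<in> V \<Longrightarrow> a * r - r * a \<in> V"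
begin

text \<open>The set \<open>T = {x. [x, R] \<subseteq> V}\<close> contains \<open>V\<close> and is a subring, since
  \<open>[xy, r] = [x, yr] + [y, rx]\<close>. For \<open>u, v \<in> T\<close> the identity \<open>[u, vr] = [u, v]r + v[u, r]\<close> puts
  \<open>[u, v]R\<close> into \<open>T\<close>, and bracketing with \<open>R\<close> puts \<open>R[u, v]R\<close> into \<open>T\<close>. Hence \<open>T = R\<close> by
  simplicity.\<close>

lemma noncommutative_lie_ideal_contains_commutators:
  assumes simple: "simple_ring TYPE('r)"
    and u: "u \<in> V" and v: "v \<in> V" and uv: "u * v \<noteq> v * u"
  shows "a * b - b * a \<in> V"
proof -
  define T where "T = {x. \<forall>r. x * r - r * x \<in> V}"
  have VT: "x \<in> T" if "x \<in> V" for x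
    using that by (simp add: T_def bracket_mem)
  have bracket_V: "x * r - r * x \<in> V" if "x \<in> T" for x r
    using that by (simp add: T_def)
  have T_add: "x + y \<in> T" if x: "x \<in> T" and y: "y \<in> T" for x y
  proof -
    have "(x + y) * r - r * (x + y) = (x * r - r * x) + (y * r - r * y)" for r
      by (simp add: algebra_simps)
    then show ?thesis
      using add_mem bracket_V[OF x] bracket_V[OF y] by (simp add: T_def)
  qed
  have T_minus: "- x \<in> T" if x: "x \<in> T" for x
  proof -
    have "(- x) * r - r * (- x) = - (x * r - r * x)" for r
      by (simp add: algebra_simps)
    then show ?thesis
      using minus_mem[OF bracket_V[OF x]] unfolding T_def by (simp only: mem_Collect_eq) blast
  qed
  have T_mult: "x * y \<in> T" if x: "x \<in> T" and y: "y \<in> T" for x y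
  proof -
    have "(x * y) * r - r * (x * y)
        = (x * (y * r) - (y * r) * x) + (y * (r * x) - (r * x) * y)" for r
      by (simp add: algebra_simps)
    then show ?thesis
      using add_mem bracket_V[OF x] bracket_V[OF y] by (simp add: T_def)
  qed
  define c where "c = u * v - v * u"
  have c_right: "c * q \<in> T" for q
  proof -
    have "c * q = (u * (v * q) - (v * q) * u) + - (v * (u * q - q * u))"
      by (simp add: c_def algebra_simps)
    then show ?thesis
      using T_add[OF _ T_minus[OF T_mult]] VT u v bracket_mem by metis
  qed
  have c_sandwich: "p * c * q \<in> T" for p q
  proof -
    have "p * c * q = c * q * p + - ((c * q) * p - p * (c * q))"
      by (simp add: algebra_simps)
    moreover have "c * q * p \<in> T"
      using c_right[of "q * p"] by (simp add: mult.assoc)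
    ultimately show ?thesis
      using T_add T_minus VT bracket_V c_right by metis
  qed
  have "T = UNIV"
  proof (rule simple_ring_additive_set_eq_UNIV[OF simple])
    show "0 \<in> T" by (rule VT[OF zero_mem])
    show "c \<noteq> 0" using uv by (simp add: c_def)
  qed (auto intro: T_add c_sandwich)
  then show ?thesis using bracket_V by blast
qed

text \<open>Modulo commutators \<open>pcq\<close> equals \<open>cqp\<close>, so a right ideal inside \<open>V\<close> drags the two-sided
  ideal that it generates into \<open>V\<close>.\<close>

lemma eq_UNIV_if_contains_right_ideal:
  assumes simple: "simple_ring TYPE('r)"
    and comm: "\<And>a b. a * b - b * a \<in> V"
    and nz: "c \<noteq> 0"
    and right: "\<And>r. c * r \<in> V"
  shows "V = UNIV"
proof (rule simple_ring_additive_set_eq_UNIV[OF simple zero_mem add_mem nz])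
  fix p q
  have "p * c * q = (p * (c * q) - (c * q) * p) + c * (q * p)"
    by (simp add: algebra_simps)
  then show "p * c * q \<in> V" using add_mem comm right by metis
qed

end

section \<open>Algebras with an involution of the first kind\<close>

locale first_kind_algebra = unital_algebra scale
  for scale :: "'f::field \<Rightarrow> 'r::ring_1 \<Rightarrow> 'r"  (infixr \<open>*s\<close> 75) +
  fixes st :: "'r \<Rightarrow> 'r"
  assumes char_not_2: "CHAR('f) \<noteq> 2"
    and inv: "involution st"
    and first: "first_kind st"
begin

abbreviation "S \<equiv> symmetric_elems st"
abbreviation "K \<equiv> skew_elems st"
abbreviation "V \<equiv> square_span scale S"

lemma two_neq_0: "(2::'f) \<noteq> 0"
proof
  assume "(2::'f) = 0"
  then have "of_nat 2 = (0::'f)" by simp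
  then have "CHAR('f) dvd 2" using of_nat_eq_0_iff_char_dvd by blast
  then have "CHAR('f) \<le> 2" "CHAR('f) \<noteq> 0" by (auto dest: dvd_imp_le intro: ccontr)
  with char_not_2 have "CHAR('f) = 1" by linarith
  then show False using of_nat_CHAR[where 'a = 'f] by simp
qed

lemma half_double: "(1 / 2) *s (a + a) = a"
proof -
  have "(1 / 2) *s (a + a) = (1 / 2) *s (2 *s a)"
    using scale_left_distrib[of 1 1 a] by simp
  also have "\<dots> = a" using two_neq_0 by simp
  finally show ?thesis .
qed

lemma st_add: "st (a + b) = st a + st b"
  and st_mult: "st (a * b) = st b * st a"
  and st_st: "st (st a) = a"
  using inv unfolding involution_def by blast+

lemma st_0: "st 0 = 0"
  using st_add[of 0 0] by simp

lemma st_minus: "st (- a) = - st a"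
  using st_add[of a "- a"] by (simp add: st_0 eq_neg_iff_add_eq_0 add.commute)

lemma st_diff: "st (a - b) = st a - st b"
  using st_add[of a "- b"] by (simp add: st_minus)

lemma st_1: "st 1 = 1"
  using st_mult[of "st 1" 1] by (simp add: st_st)

text \<open>Scalars are central, hence symmetric because the involution is of the first kind.\<close>

lemma st_scale: "st (c *s a) = c *s st a"
proof -
  have "(c *s 1) * r = r * (c *s 1)" for r
    by (simp add: scale_mult_left scale_mult_right)
  then have "st (c *s 1) = c *s 1"
    using first unfolding first_kind_def center_def symmetric_elems_def by blast
  moreover have "c *s a = (c *s 1) * a" by (simp add: scale_mult_left)
  ultimately show ?thesis by (simp add: st_mult scale_mult_right)
qed

lemma mem_S: "a \<in> S \<longleftrightarrow> st a = a"
  by (simp add: symmetric_elems_def)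

lemma mem_K: "a \<in> K \<longleftrightarrow> st a = - a"
  by (simp add: skew_elems_def)

lemma one_mem_S: "1 \<in> S"
  by (simp add: mem_S st_1)

lemma symmetric_skew_decomposition:
  obtains s k where "s \<in> S" "k \<in> K" "r = s + k"
proof
  show "(1 / 2) *s (r + st r) \<in> S"
    by (simp add: mem_S st_scale st_add st_st add.commute)
  show "(1 / 2) *s (r - st r) \<in> K"
    by (simp add: mem_K st_scale st_diff st_st flip: scale_minus_right)
  show "r = (1 / 2) *s (r + st r) + (1 / 2) *s (r - st r)"
    using half_double[of r] by (simp flip: scale_right_distrib)
qed

lemma V_0: "0 \<in> V"
  unfolding square_span_def by (rule span_zero)

lemma V_add: "a \<in> V \<Longrightarrow> b \<in> V \<Longrightarrow> a + b \<in> V"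
  unfolding square_span_def by (rule span_add)

lemma V_diff: "a \<in> V \<Longrightarrow> b \<in> V \<Longrightarrow> a - b \<in> V"
  unfolding square_span_def by (rule span_diff)

lemma V_minus: "a \<in> V \<Longrightarrow> - a \<in> V"
  unfolding square_span_def by (rule span_neg)

lemma V_scale: "a \<in> V \<Longrightarrow> c *s a \<in> V"
  unfolding square_span_def by (rule span_scale)

lemma V_mult: "a \<in> S \<Longrightarrow> b \<in> S \<Longrightarrow> a * b \<in> V"
  unfolding square_span_def by (rule span_base) blast

lemma S_subset_V: "a \<in> S \<Longrightarrow> a \<in> V"
  using V_mult[OF _ one_mem_S] by simp

lemma V_induct [consumes 1, case_names zero step]:
  assumes "v \<in> V"
    and "P 0"
    and "\<And>c a b w. a \<in> S \<Longrightarrow> b \<in> S \<Longrightarrow> P w \<Longrightarrow> P (c *s (a * b) + w)"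
  shows "P v"
  using assms(1) unfolding square_span_def
  by (rule span_induct_alt) (use assms(2,3) in blast)+

lemma st_V: "v \<in> V \<Longrightarrow> st v \<in> V"
proof (induction rule: V_induct)
  case zero
  show ?case by (simp add: st_0 V_0)
next
  case (step c a b w)
  then have "st (c *s (a * b) + w) = c *s (b * a) + st w"
    by (simp add: st_add st_scale st_mult mem_S)
  then show ?case by (simp add: V_add V_scale V_mult step)
qed

lemma bracket_S_K: "a \<in> S \<Longrightarrow> k \<in> K \<Longrightarrow> a * k - k * a \<in> S"
  by (simp add: mem_S mem_K st_diff st_mult)

lemma bracket_product_K:
  assumes "a \<in> S" "b \<in> S" "k \<in> K"
  shows "(a * b) * k - k * (a * b) \<in> V"
proof -
  have "(a * b) * k - k * (a * b) = (a * k - k * a) * b + a * (b * k - k * b)"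
    by (simp add: algebra_simps)
  then show ?thesis
    using assms by (simp add: V_add V_mult bracket_S_K)
qed

text \<open>Expanding by the derivation rule is useless here, since \<open>[a, s]\<close> is skew and a skew element
  times a symmetric one need not lie in \<open>V\<close>; splitting \<open>2ab\<close> into its symmetric and skew parts
  avoids this.\<close>

lemma bracket_product_S:
  assumes a: "a \<in> S" and b: "b \<in> S" and s: "s \<in> S"
  shows "(a * b) * s - s * (a * b) \<in> V"
proof -
  define d where "d = (a * b) * s - s * (a * b)"
  let ?p = "a * b + b * a" and ?q = "a * b - b * a"
  have "?p \<in> S" using a b by (simp add: mem_S st_add st_mult add.commute)
  then have p: "?p * s - s * ?p \<in> V" using s by (simp add: V_diff V_mult)
  have "?q \<in> K" using a b by (simp add: mem_K mem_S st_diff st_mult)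
  then have "- (s * ?q - ?q * s) \<in> V"
    using s by (intro V_minus S_subset_V bracket_S_K)
  with p have "(?p * s - s * ?p) + - (s * ?q - ?q * s) \<in> V" by (rule V_add)
  moreover have "(?p * s - s * ?p) + - (s * ?q - ?q * s) = d + d"
    by (simp add: d_def algebra_simps)
  ultimately have "(1 / 2) *s (d + d) \<in> V" using V_scale by metis
  then show ?thesis by (simp only: half_double d_def)
qed

lemma bracket_V:
  assumes "v \<in> V"
  shows "v * r - r * v \<in> V"
  using assms
proof (induction rule: V_induct)
  case zero
  show ?case by (simp add: V_0)
next
  case (step c a b w)
  obtain s k where sk: "s \<in> S" "k \<in> K" "r = s + k"
    by (rule symmetric_skew_decomposition)
  have "(a * b) * r - r * (a * b)
      = ((a * b) * s - s * (a * b)) + ((a * b) * k - k * (a * b))"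
    by (simp add: sk algebra_simps)
  then have "(a * b) * r - r * (a * b) \<in> V"
    using bracket_product_S bracket_product_K sk step.hyps by (simp add: V_add)
  moreover have "(c *s (a * b) + w) * r - r * (c *s (a * b) + w)
      = c *s ((a * b) * r - r * (a * b)) + (w * r - r * w)"
    by (simp add: distrib_left distrib_right scale_mult_left scale_mult_right
        scale_right_diff_distrib)
  ultimately show ?case by (simp only: V_add V_scale step.IH)
qed

sublocale V: additive_lie_ideal V
  by unfold_locales (auto intro: V_0 V_add V_minus bracket_V)

lemma square_span_eq_UNIV:
  assumes simple: "simple_ring TYPE('r)"
    and noncomm: "\<not> commutative_set S"
    and x: "x \<in> S" and y: "y \<in> S" and nz: "x * y + y * x \<noteq> 0"
    and xky: "\<And>k. k \<in> K \<Longrightarrow> x * k * y \<in> V"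
  shows "V = UNIV"
proof -
  from noncomm obtain u v where "u \<in> S" "v \<in> S" "u * v \<noteq> v * u"
    unfolding commutative_set_def by blast
  then have comm: "a * b - b * a \<in> V" for a b
    using V.noncommutative_lie_ideal_contains_commutators[OF simple] S_subset_V by blast
  have K_part: "(x * y + y * x) * k \<in> V" if k: "k \<in> K" for k
  proof -
    have "st (x * k * y) = - (y * k * x)"
      using x y k by (simp add: mem_S mem_K st_mult mult.assoc)
    then have ykx: "y * k * x \<in> V"
      using V_minus[OF st_V[OF xky[OF k]]] by simp
    \<comment> \<open>\<open>xyk\<close> and \<open>yxk\<close> are cyclic permutations of \<open>ykx\<close> and \<open>xky\<close>.\<close>
    have "(x * y + y * x) * k
        = (x * (y * k) - (y * k) * x) + y * k * x + ((y * (x * k) - (x * k) * y) + x * k * y)"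
      by (simp add: algebra_simps)
    then show ?thesis
      using V_add comm ykx xky[OF k] by metis
  qed
  have "x * y + y * x \<in> S"
    using x y by (simp add: mem_S st_add st_mult add.commute)
  then have "(x * y + y * x) * r \<in> V" for r
    using symmetric_skew_decomposition[of r] K_part V_mult V_add by (metis distrib_left)
  then show ?thesis
    by (rule V.eq_UNIV_if_contains_right_ideal[OF simple comm nz])
qed

lemma one_plus_one_neq_0: "(1::'r) + 1 \<noteq> 0"
  using half_double[of 1] by auto

end

theorem theorem2p26:
  fixes scale :: "'f::field \<Rightarrow> 'r::ring_1 \<Rightarrow> 'r"
    and st :: "'r \<Rightarrow> 'r"
    and S K :: "'r set"
  assumes "CHAR('f) \<noteq> 2"
    and "unital_algebra scale"
    and "simple_ring TYPE('r)"
    and "involution st"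
    and "first_kind st"
    and "S = symmetric_elems st"
    and "K = skew_elems st"
    and "S \<subset> UNIV"
    and "\<not> commutative_set S"
  shows "(\<exists>x\<in>S. \<exists>y\<in>S. x * y + y * x \<noteq> 0 \<and> (\<forall>k\<in>K. x * k * y \<in> square_span scale S))
     \<longleftrightarrow> square_span scale S = UNIV"
proof -
  interpret first_kind_algebra scale st
    using assms by (intro first_kind_algebra.intro first_kind_algebra_axioms.intro)
  show ?thesis
  proof
    assume "\<exists>x\<in>S. \<exists>y\<in>S. x * y + y * x \<noteq> 0 \<and> (\<forall>k\<in>K. x * k * y \<in> square_span scale S)"
    then show "square_span scale S = UNIV"
      using square_span_eq_UNIV assms by blast
  next
    assume "square_span scale S = UNIV"
    then show "\<exists>x\<in>S. \<exists>y\<in>S. x * y + y * x \<noteq> 0 \<and> (\<forall>k\<in>K. x * k * y \<in> square_span scale S)"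
      using one_mem_S one_plus_one_neq_0 assms(6) by (intro bexI[of _ 1]) auto
  qed
qed

end
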